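(* Let $\mu(dt):=\gamma(t,t)^{-1}dt$ on $[0,T]$, assume that $u\in L^2([0,T],d\mu)$ is a deterministic function, and let $\alpha:[0,T]\to\mathbb{R}$ be a deterministic measurable function. For $\lambda\ge0$, $t\in[0,T]$ and $x\in\mathbb{R}$ let $$\xi^{\alpha,\lambda}_t(x)=-\mathrm{sign}(x-\alpha(t))\,\min\big(\lambda\sqrt{\gamma(t,t)},|x-\alpha(t)|\big),$$ and write $\xi^{\alpha,\lambda}(X)=(\xi^{\alpha,\lambda}_t(X_t))_{t\in[0,T]}$. Then for all fixed $\lambda\ge0$ we have $$\mathbb{E}_u\big[\|X+\xi^{\alpha,\lambda}(X)-u\|^2_{L^2([0,T],d\mu)}\big]\le(1+\lambda^2)\left(T\wedge\int_0^T|u(t)-\alpha(t)|^2\,\mu(dt)\right)+T(1+\lambda)e^{-\lambda^2/2}.$$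
   Context: Let $T>0$. Under a probability measure $\mathbb{P}_u$ (with expectation $\mathbb{E}_u$) one observes a (jointly measurable) real process $X=(X_t)_{t\in[0,T]}$ decomposed as $X_t=u(t)+X^u_t$, where $(X^u_t)_{t\in[0,T]}$ is a centered Gaussian process with non-vanishing covariance function $\gamma(s,t)=\mathbb{E}_u[X^u_sX^u_t]$ (in particular $\gamma(t,t)>0$). Convention: $\mathrm{sign}(0)=0$ and $a\wedge b=\min(a,b)$. *)

theory Defs
  imports "HOL-Probability.Probability"
begin

text \<open>Point masses count as (degenerate) normal distributions, so that linear combinations of
  jointly Gaussian variables are again Gaussian.\<close>

definition gaussian_variable :: "'a measure \<Rightarrow> ('a \<Rightarrow> real) \<Rightarrow> bool" where
  "gaussian_variable M Y \<longleftrightarrow> Y \<in> borel_measurable M \<and>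
     ((\<exists>m \<sigma>. \<sigma> > 0 \<and> distributed M lborel Y (normal_density m \<sigma>)) \<or> (\<exists>m. AE \<omega> in M. Y \<omega> = m))"

definition gaussian_process :: "'a measure \<Rightarrow> 'i set \<Rightarrow> ('i \<Rightarrow> 'a \<Rightarrow> real) \<Rightarrow> bool" where
  "gaussian_process M I Z \<longleftrightarrow>
     (\<forall>J c. finite J \<and> J \<subseteq> I \<longrightarrow> gaussian_variable M (\<lambda>\<omega>. \<Sum>j\<in>J. c j * Z j \<omega>))"

definition centered_gaussian_process :: "'a measure \<Rightarrow> 'i set \<Rightarrow> ('i \<Rightarrow> 'a \<Rightarrow> real) \<Rightarrow> bool" where
  "centered_gaussian_process M I Z \<longleftrightarrow>
     gaussian_process M I Z \<and> (\<forall>t\<in>I. (\<integral>\<omega>. Z t \<omega> \<partial>M) = 0)"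

text \<open>The measure with density \<open>1 / \<gamma> t t\<close> with respect to Lebesgue measure on \<open>{0..T}\<close>.\<close>

definition weight_measure :: "(real \<Rightarrow> real \<Rightarrow> real) \<Rightarrow> real \<Rightarrow> real measure" where
  "weight_measure \<gamma> T = density (lebesgue_on {0..T}) (\<lambda>t. ennreal (1 / \<gamma> t t))"

definition in_L2 :: "'a measure \<Rightarrow> ('a \<Rightarrow> real) \<Rightarrow> bool" where
  "in_L2 N f \<longleftrightarrow> f \<in> borel_measurable N \<and> integrable N (\<lambda>t. (f t)\<^sup>2)"

text \<open>Squared L2 norm with values in \<open>[0,\<infinity>]\<close>: \<open>\<infinity>\<close> for measurable functions outside L2.\<close>

definition L2_norm_sq :: "'a measure \<Rightarrow> ('a \<Rightarrow> real) \<Rightarrow> ennreal" where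
  "L2_norm_sq N f = (\<integral>\<^sup>+t. ennreal (\<bar>f t\<bar>\<^sup>2) \<partial>N)"

definition soft_threshold ::
  "(real \<Rightarrow> real \<Rightarrow> real) \<Rightarrow> (real \<Rightarrow> real) \<Rightarrow> real \<Rightarrow> real \<Rightarrow> real \<Rightarrow> real" where
  "soft_threshold \<gamma> \<alpha> l t x =
     - sgn (x - \<alpha> t) * min (l * sqrt (\<gamma> t t)) \<bar>x - \<alpha> t\<bar>"

end

theory Submission
  imports Defs
begin

text \<open>
  The squared norm is an integral over \<open>t\<close>, so by Tonelli the risk is the integral of the risks of
  the one-dimensional problems at each \<open>t\<close>.  After division by the standard deviation
  \<open>sqrt (\<gamma> t t)\<close> the problem at \<open>t\<close> is the classical one of Donoho and Johnstone: estimate a number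
  \<open>d = (u t - \<alpha> t) / sqrt (\<gamma> t t)\<close> from one observation \<open>d + Z\<close> with \<open>Z\<close> standard normal, by
  moving the observation towards \<open>0\<close> by at most \<open>l\<close>.  The weight \<open>1 / \<gamma> t t\<close> is exactly what makes
  the noise level the same at all times.

  The normalised risk has two bounds.

  It is at most \<open>1 + l\<^sup>2\<close>: the shift applied to the observation is bounded by \<open>l\<close>, and it is
  negatively correlated with \<open>Z\<close> because it is a nonincreasing function of the observation
  (\<open>normal_risk_le_threshold\<close>).

  It is at most \<open>d\<^sup>2 + exp (- l\<^sup>2 / 2)\<close>: for each value of the noise, the loss at \<open>d\<close>
  exceeds the loss at \<open>0\<close> by at most \<open>d\<^sup>2\<close> (\<open>shrink_error_le_bias\<close>), and the risk at \<open>0\<close> is a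
  Gaussian tail moment, which a translation by \<open>l\<close> compares with the variance
  (\<open>nn_integral_shrink_std_normal\<close>).

  Using the first bound where \<open>d\<^sup>2 > 1\<close> and the second elsewhere, the risk at time \<open>t\<close> is at most
  \<open>(1 + l\<^sup>2) * min 1 (d\<^sup>2) + exp (- l\<^sup>2 / 2)\<close>.  The integral of the minimum over \<open>{0..T}\<close> is at
  most the minimum of the integrals, which are \<open>T\<close> and the weighted squared distance of \<open>u\<close> and
  \<open>\<alpha>\<close>.
\<close>

section \<open>Pointwise bounds for soft thresholding\<close>

text \<open>
  This is the estimate itself at unit noise level and centre \<open>0\<close>, whereas \<open>soft_threshold\<close> is the
  displacement that has to be added to the observation.
\<close>

definition shrink :: "real \<Rightarrow> real \<Rightarrow> real" where
  "shrink l y = y - sgn y * min l \<bar>y\<bar>"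

lemma shrink_cases:
  assumes "l \<ge> 0"
  shows "shrink l y = (if y > l then y - l else if y < - l then y + l else 0)"
  using assms by (auto simp: shrink_def sgn_if min_def)

lemma borel_measurable_shrink [measurable]: "shrink l \<in> borel_measurable borel"
  unfolding shrink_def by measurable

text \<open>
  Write \<open>c\<close> for the shift \<open>shrink l y - y\<close> at \<open>y = d + z\<close>.  In \<open>(z + c)\<^sup>2\<close> the square of \<open>c\<close> is at
  most \<open>l\<^sup>2\<close>, and the cross term does not decrease when \<open>c\<close> is replaced by the shift at \<open>z = 0\<close>,
  because the shift is nonincreasing in \<open>y\<close>.  The resulting cross term is linear in \<open>z\<close>, so it
  vanishes when \<open>z\<close> is integrated against a centred law.
\<close>

lemma shrink_error_le_threshold:
  assumes "l \<ge> 0"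
  shows "(shrink l (d + z) - d)\<^sup>2 \<le> z\<^sup>2 + l\<^sup>2 + 2 * (shrink l d - d) * z"
proof -
  define c where "c = shrink l (d + z) - (d + z)"
  have "\<bar>c\<bar> \<le> l"
    using assms by (auto simp: c_def shrink_cases)
  then have c2: "c\<^sup>2 \<le> l\<^sup>2"
    by (simp add: power2_le_iff_abs_le assms)
  have "(c - (shrink l d - d)) * z \<le> 0"
    \<comment> \<open>monotonicity of the shift between \<open>d\<close> and \<open>d + z\<close>, in either order\<close>
    using assms by (auto simp: c_def shrink_cases mult_le_0_iff)
  then have "c * z \<le> (shrink l d - d) * z"
    by (simp add: algebra_simps)
  moreover have "(shrink l (d + z) - d)\<^sup>2 = z\<^sup>2 + 2 * (c * z) + c\<^sup>2"
    by (simp add: c_def power2_eq_square algebra_simps)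
  ultimately show ?thesis
    using c2 by (simp add: algebra_simps)
qed

text \<open>
  If the estimate is \<open>0\<close>, the error is \<open>- d\<close>.  Otherwise the observation was moved by exactly \<open>l\<close>, so
  the error is, say, \<open>z - l\<close>.  For \<open>z > l\<close> this is the error \<open>shrink l z\<close> made at \<open>d = 0\<close>;
  for \<open>z \<le> l\<close> the inequality \<open>d + z > l\<close> says that the error lies between \<open>- d\<close> and \<open>0\<close>.
\<close>

lemma shrink_error_le_bias:
  assumes "l \<ge> 0"
  shows "(shrink l (d + z) - d)\<^sup>2 \<le> (shrink l z)\<^sup>2 + d\<^sup>2"
proof -
  have "\<bar>shrink l (d + z) - d\<bar> \<le> \<bar>shrink l z\<bar> \<or> \<bar>shrink l (d + z) - d\<bar> \<le> \<bar>d\<bar>"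
    using assms by (auto simp: shrink_cases)
  then have "(shrink l (d + z) - d)\<^sup>2 \<le> (shrink l z)\<^sup>2 \<or> (shrink l (d + z) - d)\<^sup>2 \<le> d\<^sup>2"
    unfolding abs_le_square_iff .
  then show ?thesis
    by (smt (verit) zero_le_power2)
qed

section \<open>The standard normal law\<close>

lemma nn_integral_std_normal_power2:
  "(\<integral>\<^sup>+z. ennreal (std_normal_density z * z\<^sup>2) \<partial>lborel) = 1"
  using integral_std_normal_moment_even[of 1] std_normal_moment_even[of 1]
  by (subst nn_integral_eq_integral) (auto simp: has_bochner_integral_iff)

lemma nn_integral_std_normal_reflect:
  assumes [measurable]: "f \<in> borel_measurable borel"
  shows "(\<integral>\<^sup>+z. ennreal (std_normal_density z * f (- z)) \<partial>lborel) =
    (\<integral>\<^sup>+z. ennreal (std_normal_density z * f z) \<partial>lborel)"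
  by (subst nn_integral_real_affine[where c = "-1" and t = 0])
     (simp_all add: normal_density_def)

lemma std_normal_density_translate:
  "std_normal_density (l + y) = exp (- l\<^sup>2 / 2) * exp (- l * y) * std_normal_density y"
  by (simp add: std_normal_density_def exp_add [symmetric] power2_eq_square field_simps)

text \<open>
  Both tails contribute equally.  Moving the right tail back to the origin by \<open>z = l + y\<close> costs the
  factor \<open>exp (- l * y) \<le> 1\<close> on \<open>y \<ge> 0\<close> and gains \<open>exp (- l\<^sup>2 / 2)\<close>; what remains of the two tails
  adds up to the variance of the standard normal law.
\<close>

lemma nn_integral_shrink_std_normal:
  assumes l: "l \<ge> 0"
  shows "(\<integral>\<^sup>+z. ennreal (std_normal_density z * (shrink l z)\<^sup>2) \<partial>lborel) \<le> ennreal (exp (- l\<^sup>2 / 2))"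
proof -
  define p where "p y = (max 0 y)\<^sup>2" for y :: real
  have [measurable]: "p \<in> borel_measurable borel"
    unfolding p_def by measurable
  have p_nonneg: "p y \<ge> 0" for y
    by (simp add: p_def)
  let ?e = "exp (- l\<^sup>2 / 2)"
  have tail: "(\<integral>\<^sup>+z. ennreal (std_normal_density z * p (z - l)) \<partial>lborel)
    \<le> (\<integral>\<^sup>+z. ennreal (?e * (std_normal_density z * p z)) \<partial>lborel)"
  proof -
    have "(\<integral>\<^sup>+z. ennreal (std_normal_density z * p (z - l)) \<partial>lborel)
      = (\<integral>\<^sup>+z. ennreal (std_normal_density (l + z) * p z) \<partial>lborel)"
      by (subst nn_integral_real_affine[where c = 1 and t = l]) simp_all
    also have "\<dots> \<le> (\<integral>\<^sup>+z. ennreal (?e * (std_normal_density z * p z)) \<partial>lborel)"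
    proof (intro nn_integral_mono ennreal_leI)
      fix y :: real
      have "exp (- l * y) * p y \<le> p y"
      proof (cases "y \<ge> 0")
        case True
        then have "exp (- l * y) \<le> 1"
          using l by simp
        then show ?thesis
          using mult_right_mono[OF _ p_nonneg, of "exp (- l * y)" 1] by simp
      qed (simp add: p_def)
      then have "(?e * std_normal_density y) * (exp (- l * y) * p y) \<le> (?e * std_normal_density y) * p y"
        by (intro mult_left_mono) simp_all
      then show "std_normal_density (l + y) * p y \<le> ?e * (std_normal_density y * p y)"
        unfolding std_normal_density_translate by (simp add: mult_ac)
    qed
    finally show ?thesis .
  qed
  have split: "(shrink l z)\<^sup>2 = p (z - l) + p (- z - l)" for z
  proof -
    consider "z > l" | "z < - l" | "\<bar>z\<bar> \<le> l"
      by linarith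
    then show ?thesis
      using l by cases (auto simp: shrink_cases p_def power2_eq_square algebra_simps)
  qed
  have "(\<integral>\<^sup>+z. ennreal (std_normal_density z * (shrink l z)\<^sup>2) \<partial>lborel)
    = (\<integral>\<^sup>+z. ennreal (std_normal_density z * p (z - l)) + ennreal (std_normal_density z * p (- z - l)) \<partial>lborel)"
    using split by (intro nn_integral_cong) (simp add: p_nonneg distrib_left flip: ennreal_plus)
  also have "\<dots> = (\<integral>\<^sup>+z. ennreal (std_normal_density z * p (z - l)) \<partial>lborel)
     + (\<integral>\<^sup>+z. ennreal (std_normal_density z * p (z - l)) \<partial>lborel)"
    using nn_integral_std_normal_reflect[of "\<lambda>z. p (z - l)"] by (subst nn_integral_add) simp_all
  also have "\<dots> \<le> (\<integral>\<^sup>+z. ennreal (?e * (std_normal_density z * p z)) \<partial>lborel)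
     + (\<integral>\<^sup>+z. ennreal (?e * (std_normal_density z * p z)) \<partial>lborel)"
    by (intro add_mono tail)
  also have "\<dots> = ennreal ?e * (\<integral>\<^sup>+z. ennreal (std_normal_density z * p z) \<partial>lborel)
     + ennreal ?e * (\<integral>\<^sup>+z. ennreal (std_normal_density z * p (- z)) \<partial>lborel)"
    using nn_integral_std_normal_reflect[of p]
    by (simp add: ennreal_mult' nn_integral_cmult)
  also have "\<dots> = ennreal ?e * (\<integral>\<^sup>+z. ennreal (std_normal_density z * z\<^sup>2) \<partial>lborel)"
    unfolding distrib_left [symmetric]
    by (subst nn_integral_add [symmetric])
      (auto intro!: arg_cong2[where f = times] nn_integral_cong simp: p_def max_def p_nonneg simp flip: ennreal_plus)
  finally show ?thesis
    by (simp add: nn_integral_std_normal_power2)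
qed

section \<open>Risk in the normalised problem\<close>

definition normal_risk :: "real \<Rightarrow> real \<Rightarrow> ennreal" where
  "normal_risk l d = (\<integral>\<^sup>+z. ennreal (std_normal_density z * (shrink l (d + z) - d)\<^sup>2) \<partial>lborel)"

lemma normal_risk_le_threshold:
  assumes "l \<ge> 0"
  shows "normal_risk l d \<le> ennreal (1 + l\<^sup>2)"
proof -
  let ?b = "shrink l d - d"
  have quad: "has_bochner_integral lborel
     (\<lambda>z. std_normal_density z * (z\<^sup>2 + l\<^sup>2 + 2 * ?b * z)) (1 + l\<^sup>2)"
  proof -
    have "has_bochner_integral lborel (\<lambda>z. std_normal_density z * z ^ (2 * 1)
       + l\<^sup>2 * (std_normal_density z * z ^ (2 * 0)) + (2 * ?b) * (std_normal_density z * z ^ (2 * 0 + 1)))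
       (1 + l\<^sup>2 * 1 + (2 * ?b) * 0)"
      using std_normal_moment_even[of 1] std_normal_moment_even[of 0] std_normal_moment_odd[of 0]
      by (intro has_bochner_integral_add has_bochner_integral_mult_right) simp_all
    then show ?thesis
      by (simp add: algebra_simps power2_eq_square)
  qed
  have pos: "0 \<le> z\<^sup>2 + l\<^sup>2 + 2 * ?b * z" for z
    using shrink_error_le_threshold[OF assms, of d z] by (rule order_trans[OF zero_le_power2])
  have "normal_risk l d \<le> (\<integral>\<^sup>+z. ennreal (std_normal_density z * (z\<^sup>2 + l\<^sup>2 + 2 * ?b * z)) \<partial>lborel)"
    unfolding normal_risk_def
    by (intro nn_integral_mono ennreal_leI mult_left_mono shrink_error_le_threshold assms) simp
  also have "\<dots> = ennreal (1 + l\<^sup>2)"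
    using quad pos by (subst nn_integral_eq_integral) (auto simp: has_bochner_integral_iff)
  finally show ?thesis .
qed

lemma normal_risk_le_bias:
  assumes l: "l \<ge> 0"
  shows "normal_risk l d \<le> ennreal (d\<^sup>2 + exp (- l\<^sup>2 / 2))"
proof -
  let ?f = "\<lambda>z. (shrink l (d + z) - d)\<^sup>2"
  have one: "(\<integral>\<^sup>+z. ennreal (std_normal_density z) \<partial>lborel) = 1"
    using std_normal_moment_even[of 0]
    by (subst nn_integral_eq_integral) (auto simp: has_bochner_integral_iff)
  have "normal_risk l d
     \<le> (\<integral>\<^sup>+z. ennreal (std_normal_density z * (shrink l z)\<^sup>2 + d\<^sup>2 * std_normal_density z) \<partial>lborel)"
    unfolding normal_risk_def
  proof (intro nn_integral_mono ennreal_leI)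
    fix z :: real
    have "std_normal_density z * ?f z \<le> std_normal_density z * ((shrink l z)\<^sup>2 + d\<^sup>2)"
      using shrink_error_le_bias[OF l, of d z] by (intro mult_left_mono) simp_all
    then show "std_normal_density z * ?f z
       \<le> std_normal_density z * (shrink l z)\<^sup>2 + d\<^sup>2 * std_normal_density z"
      by (simp add: algebra_simps)
  qed
  also have "\<dots> = (\<integral>\<^sup>+z. ennreal (std_normal_density z * (shrink l z)\<^sup>2) \<partial>lborel) + ennreal (d\<^sup>2)"
    by (simp add: ennreal_mult' ennreal_plus nn_integral_cmult nn_integral_add one del: ennreal_plus_if)
  also have "\<dots> \<le> ennreal (exp (- l\<^sup>2 / 2)) + ennreal (d\<^sup>2)"
    by (intro add_mono nn_integral_shrink_std_normal l) simp_all
  finally show ?thesis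
    by (simp add: add.commute)
qed

lemma normal_risk_le:
  assumes "l \<ge> 0"
  shows "normal_risk l d \<le> ennreal ((1 + l\<^sup>2) * min 1 (d\<^sup>2) + exp (- l\<^sup>2 / 2))"
proof (cases "d\<^sup>2 \<le> 1")
  case True
  have "d\<^sup>2 \<le> (1 + l\<^sup>2) * d\<^sup>2"
    by (simp add: algebra_simps)
  then show ?thesis
    using True by (intro order_trans[OF normal_risk_le_bias[OF assms]] ennreal_leI) (simp add: min_def)
next
  case False
  then show ?thesis
    by (intro order_trans[OF normal_risk_le_threshold[OF assms]] ennreal_leI) (simp add: min_def)
qed

section \<open>Reduction of the process to the normalised problem\<close>

text \<open>
  A marginal is a single Gaussian variable; the positive second moment rules out the degenerate
  case, which with mean \<open>0\<close> would be the point mass at \<open>0\<close>.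
\<close>

lemma (in prob_space) centered_gaussian_process_marginal:
  assumes gauss: "centered_gaussian_process M I Z" and t: "t \<in> I"
    and pos: "(\<integral>\<omega>. Z t \<omega> * Z t \<omega> \<partial>M) > 0"
  shows "distributed M lborel (\<lambda>\<omega>. Z t \<omega> / sqrt (\<integral>\<omega>. Z t \<omega> * Z t \<omega> \<partial>M)) std_normal_density"
proof -
  have mean: "expectation (Z t) = 0"
    using gauss t by (auto simp: centered_gaussian_process_def)
  have "gaussian_variable M (\<lambda>\<omega>. \<Sum>j\<in>{t}. 1 * Z j \<omega>)"
    using gauss t unfolding centered_gaussian_process_def gaussian_process_def
    by (elim conjE allE[of _ "{t}"] allE[of _ "\<lambda>_. 1"]) simp
  then have gv: "gaussian_variable M (Z t)"
    by simp
  then have [measurable]: "Z t \<in> borel_measurable M"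
    by (simp add: gaussian_variable_def)
  have "\<not> (AE \<omega> in M. Z t \<omega> = m)" for m
  proof
    assume ae: "AE \<omega> in M. Z t \<omega> = m"
    have "expectation (Z t) = expectation (\<lambda>_. m)"
      using ae by (intro integral_cong_AE) auto
    then have "m = 0"
      using mean by (simp add: prob_space)
    then have "(\<integral>\<omega>. Z t \<omega> * Z t \<omega> \<partial>M) = expectation (\<lambda>_. 0)"
      using ae by (intro integral_cong_AE) auto
    then show False
      using pos by simp
  qed
  then obtain m s where s: "s > 0" and dist: "distributed M lborel (Z t) (normal_density m s)"
    using gv by (auto simp: gaussian_variable_def)
  have "m = 0"
    using normal_distributed_expectation[OF s dist] mean by simp
  have "(\<integral>\<omega>. Z t \<omega> * Z t \<omega> \<partial>M) = s\<^sup>2"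
    using normal_distributed_variance[OF s dist] mean by (simp add: power2_eq_square)
  then show ?thesis
    using normal_standard_normal_convert[OF s, of "Z t" m] dist s \<open>m = 0\<close>
    by simp
qed

text \<open>
  Soft thresholding commutes with rescaling: thresholding \<open>x - \<alpha> t\<close> at level \<open>l * sqrt (\<gamma> t t)\<close> is
  thresholding \<open>(x - \<alpha> t) / sqrt (\<gamma> t t)\<close> at level \<open>l\<close>.
\<close>

lemma normalised_soft_threshold_error:
  assumes "\<gamma> t t > 0"
  shows "1 / \<gamma> t t * \<bar>x + soft_threshold \<gamma> \<alpha> l t x - v\<bar>\<^sup>2 =
    (shrink l ((v - \<alpha> t) / sqrt (\<gamma> t t) + (x - v) / sqrt (\<gamma> t t)) - (v - \<alpha> t) / sqrt (\<gamma> t t))\<^sup>2"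
proof -
  define s where "s = sqrt (\<gamma> t t)"
  have s: "s > 0" "\<gamma> t t = s\<^sup>2"
    using assms by (auto simp: s_def)
  have y: "(v - \<alpha> t) / s + (x - v) / s = (x - \<alpha> t) / s"
    by (simp flip: add_divide_distrib)
  have m: "min l \<bar>(x - \<alpha> t) / s\<bar> = min (l * s) \<bar>x - \<alpha> t\<bar> / s"
    using s by (simp add: min_def field_simps)
  have "shrink l ((x - \<alpha> t) / s) - (v - \<alpha> t) / s = (x + soft_threshold \<gamma> \<alpha> l t x - v) / s"
    using s unfolding shrink_def m soft_threshold_def s_def [symmetric]
    by (simp add: sgn_divide field_simps)
  then show ?thesis
    using s unfolding s_def [symmetric] y by (simp add: power_divide)
qed

lemma nn_integral_min_le_min:
  assumes "T \<ge> 0"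
  shows "(\<integral>\<^sup>+t. min 1 (g t) \<partial>lebesgue_on {0..T}) \<le> min (ennreal T) (\<integral>\<^sup>+t. g t \<partial>lebesgue_on {0..T})"
proof -
  have "(\<integral>\<^sup>+t. min 1 (g t) \<partial>lebesgue_on {0..T}) \<le> (\<integral>\<^sup>+t. 1 \<partial>lebesgue_on {0..T})"
    by (intro nn_integral_mono) simp
  also have "\<dots> = ennreal T"
    using assms by (simp add: emeasure_restrict_space)
  finally show ?thesis
    by (auto intro!: nn_integral_mono)
qed

theorem proposition4p2:
  fixes M :: "'a measure"
    and T :: real
    and X Xu :: "real \<Rightarrow> 'a \<Rightarrow> real"
    and u \<alpha> :: "real \<Rightarrow> real"
    and \<gamma> :: "real \<Rightarrow> real \<Rightarrow> real"
    and l :: real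
  assumes "prob_space M"
    and "T > 0"
    and X_meas: "(\<lambda>(t, \<omega>). X t \<omega>) \<in> borel_measurable (lebesgue_on {0..T} \<Otimes>\<^sub>M M)"
    and decomp: "\<And>t \<omega>. t \<in> {0..T} \<Longrightarrow> \<omega> \<in> space M \<Longrightarrow> X t \<omega> = u t + Xu t \<omega>"
    and gauss: "centered_gaussian_process M {0..T} Xu"
    and cov: "\<And>s t. s \<in> {0..T} \<Longrightarrow> t \<in> {0..T} \<Longrightarrow> \<gamma> s t = (\<integral>\<omega>. Xu s \<omega> * Xu t \<omega> \<partial>M)"
    and cov_pos: "\<And>t. t \<in> {0..T} \<Longrightarrow> \<gamma> t t > 0"
    and u_L2: "in_L2 (weight_measure \<gamma> T) u"
    and \<alpha>_meas: "\<alpha> \<in> borel_measurable (lebesgue_on {0..T})"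
    and "l \<ge> 0"
  shows "(\<integral>\<^sup>+\<omega>. L2_norm_sq (weight_measure \<gamma> T)
              (\<lambda>t. X t \<omega> + soft_threshold \<gamma> \<alpha> l t (X t \<omega>) - u t) \<partial>M)
         \<le> ennreal (1 + l\<^sup>2) *
             min (ennreal T) (\<integral>\<^sup>+t. ennreal (\<bar>u t - \<alpha> t\<bar>\<^sup>2) \<partial>(weight_measure \<gamma> T))
           + ennreal (T * (1 + l) * exp (- l\<^sup>2 / 2))"
proof -
  interpret prob_space M by fact
  let ?L = "lebesgue_on {0..T}"
  interpret L: finite_measure ?L
    by standard (simp add: emeasure_restrict_space emeasure_lborel_Icc_eq)
  interpret P: pair_sigma_finite ?L M ..
  note [measurable] = \<alpha>_meas
  have [measurable]: "u \<in> borel_measurable ?L"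
    using u_L2 by (simp add: in_L2_def weight_measure_def)
  have [measurable]: "(\<lambda>p. X (fst p) (snd p)) \<in> borel_measurable (?L \<Otimes>\<^sub>M M)"
    using X_meas by (simp add: case_prod_unfold)
  \<comment> \<open>The variance is a measurable function of time, as an integral of the jointly measurable
    \<open>X\<close>; this is what gives meaning to the density in the weighted measure.\<close>
  have "(\<lambda>t. \<integral>\<omega>. (X t \<omega> - u t) * (X t \<omega> - u t) \<partial>M) \<in> borel_measurable ?L"
    by measurable
  also have "?this \<longleftrightarrow> (\<lambda>t. \<gamma> t t) \<in> borel_measurable ?L"
    by (intro measurable_cong) (auto simp: cov decomp intro!: Bochner_Integration.integral_cong)
  finally have [measurable]: "(\<lambda>t. \<gamma> t t) \<in> borel_measurable ?L" .
  define d where "d t = (u t - \<alpha> t) / sqrt (\<gamma> t t)" for t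
  have [measurable]: "d \<in> borel_measurable ?L"
    unfolding d_def by measurable
  define e where "e t \<omega> = X t \<omega> + soft_threshold \<gamma> \<alpha> l t (X t \<omega>) - u t" for t \<omega>
  have [measurable]: "(\<lambda>p. e (fst p) (snd p)) \<in> borel_measurable (?L \<Otimes>\<^sub>M M)"
    unfolding e_def soft_threshold_def by measurable
  have weighted: "(\<integral>\<^sup>+t. ennreal (\<bar>g t\<bar>\<^sup>2) \<partial>weight_measure \<gamma> T) = (\<integral>\<^sup>+t. ennreal (1 / \<gamma> t t * \<bar>g t\<bar>\<^sup>2) \<partial>?L)"
    if [measurable]: "g \<in> borel_measurable ?L" for g
    unfolding weight_measure_def using cov_pos
    by (subst nn_integral_density) (auto intro!: nn_integral_cong simp: less_imp_le simp flip: ennreal_mult')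
  have risk: "(\<integral>\<^sup>+\<omega>. ennreal (1 / \<gamma> t t * \<bar>e t \<omega>\<bar>\<^sup>2) \<partial>M) = normal_risk l (d t)"
    if t: "t \<in> {0..T}" for t
  proof -
    have "distributed M lborel (\<lambda>\<omega>. Xu t \<omega> / sqrt (\<gamma> t t)) std_normal_density"
      using centered_gaussian_process_marginal[OF gauss t] cov_pos[OF t] cov[OF t t] by simp
    from distributed_nn_integral[OF this, of "\<lambda>z. ennreal ((shrink l (d t + z) - d t)\<^sup>2)"]
    have "(\<integral>\<^sup>+\<omega>. ennreal ((shrink l (d t + Xu t \<omega> / sqrt (\<gamma> t t)) - d t)\<^sup>2) \<partial>M) = normal_risk l (d t)"
      by (simp add: normal_risk_def ennreal_mult')
    moreover have "1 / \<gamma> t t * \<bar>e t \<omega>\<bar>\<^sup>2 = (shrink l (d t + Xu t \<omega> / sqrt (\<gamma> t t)) - d t)\<^sup>2"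
      if "\<omega> \<in> space M" for \<omega>
      using normalised_soft_threshold_error[of \<gamma> t "X t \<omega>" \<alpha> l "u t"] cov_pos[OF t] decomp[OF t that]
      by (simp add: e_def d_def)
    ultimately show ?thesis
      by (simp cong: nn_integral_cong)
  qed
  have "(\<integral>\<^sup>+\<omega>. L2_norm_sq (weight_measure \<gamma> T) (\<lambda>t. e t \<omega>) \<partial>M)
     = (\<integral>\<^sup>+\<omega>. (\<integral>\<^sup>+t. ennreal (1 / \<gamma> t t * \<bar>e t \<omega>\<bar>\<^sup>2) \<partial>?L) \<partial>M)"
    unfolding L2_norm_sq_def
    using measurable_Pair1[of "\<lambda>p. e (fst p) (snd p)" ?L M borel]
    by (intro nn_integral_cong weighted) simp
  also have "\<dots> = (\<integral>\<^sup>+t. (\<integral>\<^sup>+\<omega>. ennreal (1 / \<gamma> t t * \<bar>e t \<omega>\<bar>\<^sup>2) \<partial>M) \<partial>?L)"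
    by (intro P.Fubini') measurable
  also have "\<dots> \<le> (\<integral>\<^sup>+t. ennreal ((1 + l\<^sup>2) * min 1 ((d t)\<^sup>2) + exp (- l\<^sup>2 / 2)) \<partial>?L)"
    using risk normal_risk_le[OF \<open>l \<ge> 0\<close>] by (intro nn_integral_mono) simp
  also have "\<dots> = (\<integral>\<^sup>+t. ennreal (1 + l\<^sup>2) * min 1 (ennreal ((d t)\<^sup>2)) + ennreal (exp (- l\<^sup>2 / 2)) \<partial>?L)"
  proof (intro nn_integral_cong)
    fix t
    have "ennreal (min 1 ((d t)\<^sup>2)) = min 1 (ennreal ((d t)\<^sup>2))"
      by (simp add: min_def)
    then show "ennreal ((1 + l\<^sup>2) * min 1 ((d t)\<^sup>2) + exp (- l\<^sup>2 / 2))
       = ennreal (1 + l\<^sup>2) * min 1 (ennreal ((d t)\<^sup>2)) + ennreal (exp (- l\<^sup>2 / 2))"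
      by (simp add: ennreal_mult' ennreal_plus del: ennreal_plus_if)
  qed
  also have "\<dots> = ennreal (1 + l\<^sup>2) * (\<integral>\<^sup>+t. min 1 (ennreal ((d t)\<^sup>2)) \<partial>?L) + ennreal (exp (- l\<^sup>2 / 2)) * ennreal T"
    using \<open>T > 0\<close> by (simp add: nn_integral_add nn_integral_cmult emeasure_restrict_space)
  also have "\<dots> \<le> ennreal (1 + l\<^sup>2) * min (ennreal T) (\<integral>\<^sup>+t. ennreal ((d t)\<^sup>2) \<partial>?L)
      + ennreal (T * (1 + l) * exp (- l\<^sup>2 / 2))"
  proof (intro add_mono mult_left_mono nn_integral_min_le_min)
    have "exp (- l\<^sup>2 / 2) * T \<le> T * (1 + l) * exp (- l\<^sup>2 / 2)"
      using \<open>T > 0\<close> \<open>l \<ge> 0\<close> by (simp add: algebra_simps)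
    then show "ennreal (exp (- l\<^sup>2 / 2)) * ennreal T \<le> ennreal (T * (1 + l) * exp (- l\<^sup>2 / 2))"
      using \<open>T > 0\<close> by (simp flip: ennreal_mult' add: ennreal_leI)
  qed (use \<open>T > 0\<close> in simp_all)
  also have "(\<integral>\<^sup>+t. ennreal ((d t)\<^sup>2) \<partial>?L) = (\<integral>\<^sup>+t. ennreal (\<bar>u t - \<alpha> t\<bar>\<^sup>2) \<partial>weight_measure \<gamma> T)"
    using cov_pos by (subst weighted) (auto intro!: nn_integral_cong simp: d_def power_divide less_imp_le)
  finally show ?thesis
    unfolding e_def .
qed

end
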